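(* Let $A\in\mathbb{R}^{m\times n}$ and $b\in\mathbb{R}^m$ satisfy the standing assumptions in the context. Let $\bar C_k$ be the best rank $k$ approximation to $\bar B_{k+1}$ with respect to the 2-norm. Then for $k=1,2,\ldots,n-1$, $$\|A-P_{k+1}\bar C_kQ_{k+1}^T\|\le\sigma_{k+1}+\gamma_{k+1}^{cgme},$$ $$\|A-P_{k+1}\bar C_kQ_{k+1}^T\|\le\bar\theta_{k+1}^{(k+1)}+\gamma_{k+1}^{cgme},$$ where $\bar\theta_{k+1}^{(k+1)}$ is the smallest singular value of $\bar B_{k+1}$ and $\gamma_{k+1}^{cgme}=\|A-P_{k+1}\bar B_{k+1}Q_{k+1}^T\|=\|(I-P_{k+1}P_{k+1}^T)A\|$.
   Context: $\|\cdot\|$ is the 2-norm of a vector or matrix. $A\in\mathbb{R}^{m\times n}$ with $m\ge n$ has simple positive singular values $\sigma_1>\sigma_2>\cdots>\sigma_n>0$, with left singular vectors $u_1,\ldots,u_m$ forming an orthonormal basis of $\mathbb{R}^m$, and $b\in\mathbb{R}^m$ satisfies $u_i^Tb\neq 0$ for $i=1,\ldots,n$. Lanczos bidiagonalization: set $\beta_1=\|b\|$, $p_1=b/\|b\|$, and $\beta_1q_0$ is taken to be $\mathbf{0}$. For $j=1,2,\ldots$: $r=A^Tp_j-\beta_jq_{j-1}$, $\alpha_j=\|r\|$, $q_j=r/\alpha_j$; $z=Aq_j-\alpha_jp_j$, $\beta_{j+1}=\|z\|$, $p_{j+1}=z/\beta_{j+1}$. The vectors $q_1,q_2,\ldots$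 are orthonormal, and so are $p_1,p_2,\ldots$. Standing assumption: the process does not break down before step $n$, i.e. $\alpha_1,\ldots,\alpha_n>0$ and $\beta_2,\ldots,\beta_n>0$; moreover $\beta_{n+1}>0$ if $m>n$, while necessarily $\beta_{n+1}=0$ if $m=n$. Write $P_k=(p_1,\ldots,p_k)$, $Q_k=(q_1,\ldots,q_k)$, and let $\bar B_k=P_k^TAQ_k\in\mathbb{R}^{k\times k}$, the lower bidiagonal matrix with diagonal $\alpha_1,\ldots,\alpha_k$ and subdiagonal $\beta_2,\ldots,\beta_k$; then $P_k\bar B_kQ_k^T=P_kP_k^TA$. A best rank $k$ approximation to a matrix in the 2-norm is the one obtained by truncating its SVD to the $k$ largest singular values. *)

theory Defs
  imports Complex_Main "Jordan_Normal_Form.Matrix"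
begin

text \<open>
  Matrix dimensions vary with the step number, so matrices and vectors are those of
  \<^theory>\<open>Jordan_Normal_Form.Matrix\<close>. Their entries are indexed from 0. The families
  of singular values, Lanczos coefficients and Lanczos vectors are indexed from 1.
\<close>

definition vec_norm2 :: "real vec \<Rightarrow> real" where
  "vec_norm2 v = sqrt (v \<bullet> v)"

definition mat_norm2 :: "real mat \<Rightarrow> real" where
  "mat_norm2 M = Sup {vec_norm2 (M *\<^sub>v x) | x. x \<in> carrier_vec (dim_col M) \<and> vec_norm2 x \<le> 1}"


definition diag_rect :: "nat \<Rightarrow> nat \<Rightarrow> (nat \<Rightarrow> real) \<Rightarrow> real mat" where
  "diag_rect r c s = mat r c (\<lambda>(i, j). if i = j then s (Suc i) else 0)"

text \<open>
  Full singular value decomposition \<open>M = U * \<Sigma> * V\<^sup>T\<close>: the columns of \<open>U\<close> and \<open>V\<close> are the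
  left and right singular vectors, each family being an orthonormal basis.
  Only \<open>s 1 \<ge> \<dots> \<ge> s (min r c)\<close> are meaningful.
\<close>

definition is_svd :: "real mat \<Rightarrow> real mat \<Rightarrow> (nat \<Rightarrow> real) \<Rightarrow> real mat \<Rightarrow> bool" where
  "is_svd M U s V \<longleftrightarrow>
     (let r = dim_row M; c = dim_col M in
        U \<in> carrier_mat r r \<and> transpose_mat U * U = 1\<^sub>m r \<and>
        V \<in> carrier_mat c c \<and> transpose_mat V * V = 1\<^sub>m c \<and>
        (\<forall>i\<in>{1..min r c}. 0 \<le> s i) \<and>
        (\<forall>i j. 1 \<le> i \<longrightarrow> i \<le> j \<longrightarrow> j \<le> min r c \<longrightarrow> s j \<le> s i) \<and>
        M = U * diag_rect r c s * transpose_mat V)"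

definition is_singular_values :: "real mat \<Rightarrow> (nat \<Rightarrow> real) \<Rightarrow> bool" where
  "is_singular_values M s \<longleftrightarrow> (\<exists>U V. is_svd M U s V)"

text \<open>
  Minimisers of the 2-norm error among matrices of rank at most \<open>k\<close> are not unique in general;
  the best rank \<open>k\<close> approximation is by convention a truncated singular value decomposition.
\<close>

definition is_best_rank_approx :: "nat \<Rightarrow> real mat \<Rightarrow> real mat \<Rightarrow> bool" where
  "is_best_rank_approx k M C \<longleftrightarrow>
     (\<exists>U s V. is_svd M U s V \<and>
        C = U * diag_rect (dim_row M) (dim_col M) (\<lambda>i. if i \<le> k then s i else 0) * transpose_mat V)"


text \<open>
  Lanczos bidiagonalization of \<open>A\<close> started with \<open>b\<close>, run for \<open>dim_col A\<close> steps.
  Setting \<open>q 0 = 0\<close> encodes that the term \<open>\<beta> 1 \<cdot>\<^sub>v q 0\<close> is zero. Absence of breakdown is not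
  included: after a breakdown, division by zero makes the next vector zero.
\<close>

definition lanczos_bidiag ::
  "real mat \<Rightarrow> real vec \<Rightarrow> (nat \<Rightarrow> real) \<Rightarrow> (nat \<Rightarrow> real) \<Rightarrow> (nat \<Rightarrow> real vec) \<Rightarrow> (nat \<Rightarrow> real vec) \<Rightarrow> bool" where
  "lanczos_bidiag A b \<alpha> \<beta> p q \<longleftrightarrow>
     \<beta> 1 = vec_norm2 b \<and> p 1 = (1 / vec_norm2 b) \<cdot>\<^sub>v b \<and> q 0 = 0\<^sub>v (dim_col A) \<and>
     (\<forall>j\<in>{1..dim_col A}.
        (let r = transpose_mat A *\<^sub>v p j - \<beta> j \<cdot>\<^sub>v q (j - 1) in
           \<alpha> j = vec_norm2 r \<and> q j = (1 / \<alpha> j) \<cdot>\<^sub>v r) \<and>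
        (let z = A *\<^sub>v q j - \<alpha> j \<cdot>\<^sub>v p j in
           \<beta> (j + 1) = vec_norm2 z \<and> p (j + 1) = (1 / \<beta> (j + 1)) \<cdot>\<^sub>v z))"

definition lanczos_P :: "real mat \<Rightarrow> (nat \<Rightarrow> real vec) \<Rightarrow> nat \<Rightarrow> real mat" where
  "lanczos_P A p k = mat_of_cols (dim_row A) (map p [1..<k + 1])"

definition lanczos_Q :: "real mat \<Rightarrow> (nat \<Rightarrow> real vec) \<Rightarrow> nat \<Rightarrow> real mat" where
  "lanczos_Q A q k = mat_of_cols (dim_col A) (map q [1..<k + 1])"

definition lanczos_Bbar :: "real mat \<Rightarrow> (nat \<Rightarrow> real vec) \<Rightarrow> (nat \<Rightarrow> real vec) \<Rightarrow> nat \<Rightarrow> real mat" where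
  "lanczos_Bbar A p q k = transpose_mat (lanczos_P A p k) * A * lanczos_Q A q k"

definition gamma_cgme :: "real mat \<Rightarrow> (nat \<Rightarrow> real vec) \<Rightarrow> (nat \<Rightarrow> real vec) \<Rightarrow> nat \<Rightarrow> real" where
  "gamma_cgme A p q k =
     mat_norm2 (A - lanczos_P A p k * lanczos_Bbar A p q k * transpose_mat (lanczos_Q A q k))"

end

theory Submission
  imports Defs "Jordan_Normal_Form.Determinant" "HOL-Analysis.L2_Norm"
begin

text \<open>
  Write \<open>P\<close>, \<open>Q\<close>, \<open>B\<close> for the Lanczos matrices of step \<open>k + 1\<close>. As long as the process does not break
  down, its two recurrences imply by induction that the columns of \<open>P\<close> and of \<open>Q\<close> are orthonormal
  (\<open>lanczos_orthonormal\<close>). Moreover \<open>A\<^sup>T p\<^sub>j\<close> lies in the span of the columns of \<open>Q\<close>, so that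
  \<open>B Q\<^sup>T = P\<^sup>T A\<close> (\<open>lanczos_Bbar_mult_transpose_Q\<close>). Hence \<open>P B Q\<^sup>T = P P\<^sup>T A\<close>, which gives the second
  expression for \<open>\<gamma>\<close>.

  From \<open>A - P C Q\<^sup>T = (A - P B Q\<^sup>T) + P (B - C) Q\<^sup>T\<close> and the triangle inequality, the error is at most
  \<open>\<gamma> + \<parallel>B - C\<parallel>\<close>, where \<open>\<parallel>B - C\<parallel>\<close> is bounded by the smallest singular value \<open>\<theta>\<close> of \<open>B\<close>, the only one
  that the truncation discards (\<open>best_rank_approx_error\<close>). It remains to see that \<open>\<theta>\<close> is at most the
  singular value \<open>\<sigma>\<close> of \<open>A\<close> with index \<open>k + 1\<close> (\<open>singular_value_projected_le\<close>). A dimension count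
  gives \<open>y \<noteq> 0\<close> with \<open>P y\<close> orthogonal to the first \<open>k\<close> left singular vectors of \<open>A\<close>, and then
  \<open>\<theta> \<parallel>y\<parallel> \<le> \<parallel>B\<^sup>T y\<parallel> = \<parallel>Q B\<^sup>T y\<parallel> = \<parallel>A\<^sup>T P y\<parallel> \<le> \<sigma> \<parallel>P y\<parallel> = \<sigma> \<parallel>y\<parallel>\<close>.
\<close>

section \<open>The 2-norm of vectors and matrices\<close>

lemma vec_norm2_eq_L2_set: "vec_norm2 v = L2_set (\<lambda>i. v $ i) {0..<dim_vec v}"
  unfolding vec_norm2_def scalar_prod_def L2_set_def power2_eq_square by simp

lemma vec_norm2_nonneg: "0 \<le> vec_norm2 v"
  by (simp add: vec_norm2_eq_L2_set)

lemma vec_norm2_square: "(vec_norm2 v)\<^sup>2 = v \<bullet> v"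
  unfolding vec_norm2_def scalar_prod_def by (simp add: sum_nonneg)

lemma vec_norm2_pos:
  assumes "v \<in> carrier_vec d" "v \<noteq> 0\<^sub>v d"
  shows "0 < vec_norm2 v"
proof -
  have "vec_norm2 v \<noteq> 0"
  proof
    assume "vec_norm2 v = 0"
    then have "\<forall>i\<in>{0..<dim_vec v}. v $ i = 0"
      by (simp add: vec_norm2_eq_L2_set L2_set_eq_0_iff)
    then have "v = 0\<^sub>v d" using assms(1) by (intro eq_vecI) auto
    with assms(2) show False by simp
  qed
  with vec_norm2_nonneg[of v] show ?thesis by linarith
qed

lemma vec_norm2_smult: "vec_norm2 (c \<cdot>\<^sub>v v) = \<bar>c\<bar> * vec_norm2 v"
proof -
  have "(c \<cdot>\<^sub>v v) \<bullet> (c \<cdot>\<^sub>v v) = c\<^sup>2 * (v \<bullet> v)"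
    by (simp add: power2_eq_square)
  then show ?thesis unfolding vec_norm2_def by (simp add: real_sqrt_mult)
qed

lemma vec_norm2_triangle:
  assumes "v \<in> carrier_vec d" "w \<in> carrier_vec d"
  shows "vec_norm2 (v + w) \<le> vec_norm2 v + vec_norm2 w"
proof -
  have "vec_norm2 (v + w) = L2_set (\<lambda>i. v $ i + w $ i) {0..<d}"
    using assms unfolding vec_norm2_eq_L2_set by (intro L2_set_cong) auto
  also have "\<dots> \<le> L2_set (\<lambda>i. v $ i) {0..<d} + L2_set (\<lambda>i. w $ i) {0..<d}"
    by (rule L2_set_triangle_ineq)
  finally show ?thesis using assms by (simp add: vec_norm2_eq_L2_set)
qed

lemma Cauchy_Schwarz_vec:
  assumes "v \<in> carrier_vec d" "w \<in> carrier_vec d"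
  shows "\<bar>v \<bullet> w\<bar> \<le> vec_norm2 v * vec_norm2 w"
proof -
  have "\<bar>v \<bullet> w\<bar> \<le> (\<Sum>i\<in>{0..<d}. \<bar>v $ i * w $ i\<bar>)"
    using assms unfolding scalar_prod_def by (metis carrier_vecD sum_abs)
  also have "\<dots> = (\<Sum>i\<in>{0..<d}. \<bar>v $ i\<bar> * \<bar>w $ i\<bar>)" by (simp add: abs_mult)
  also have "\<dots> \<le> vec_norm2 v * vec_norm2 w"
    using assms by (simp add: vec_norm2_eq_L2_set L2_set_mult_ineq)
  finally show ?thesis .
qed

lemma vec_norm2_le_scaled:
  assumes "v \<in> carrier_vec d" "w \<in> carrier_vec d" "0 \<le> c"
    and "\<And>i. i < d \<Longrightarrow> \<bar>v $ i\<bar> \<le> c * \<bar>w $ i\<bar>"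
  shows "vec_norm2 v \<le> c * vec_norm2 w"
proof -
  have "v \<bullet> v \<le> (c \<cdot>\<^sub>v w) \<bullet> (c \<cdot>\<^sub>v w)"
    unfolding scalar_prod_def
  proof (simp, use assms in \<open>simp\<close>, rule sum_mono)
    fix i assume "i \<in> {0..<d}"
    then have "\<bar>v $ i\<bar> \<le> \<bar>c * w $ i\<bar>" using assms by (simp add: abs_mult)
    then have "(v $ i)\<^sup>2 \<le> (c * w $ i)\<^sup>2" by (simp add: abs_le_square_iff)
    then show "v $ i * v $ i \<le> c * w $ i * (c * w $ i)"
      by (simp add: power2_eq_square)
  qed
  then have "vec_norm2 v \<le> vec_norm2 (c \<cdot>\<^sub>v w)" unfolding vec_norm2_def by simp
  with \<open>0 \<le> c\<close> show ?thesis by (simp add: vec_norm2_smult)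
qed

text \<open>
  The set of values over which \<^const>\<open>mat_norm2\<close> takes a supremum is bounded, by the sum of
  the norms of the rows. Without this the supremum of real numbers would be unspecified.
\<close>

lemma vec_norm2_mult_mat_vec_le:
  assumes "x \<in> carrier_vec (dim_col M)" "vec_norm2 x \<le> 1"
  shows "vec_norm2 (M *\<^sub>v x) \<le> mat_norm2 M"
proof -
  let ?S = "{vec_norm2 (M *\<^sub>v x) | x. x \<in> carrier_vec (dim_col M) \<and> vec_norm2 x \<le> 1}"
  have "bdd_above ?S"
  proof (rule bdd_aboveI)
    fix t assume "t \<in> ?S"
    then obtain y where t: "t = vec_norm2 (M *\<^sub>v y)"
      and y: "y \<in> carrier_vec (dim_col M)" "vec_norm2 y \<le> 1" by auto
    have "t \<le> (\<Sum>i\<in>{0..<dim_row M}. \<bar>(M *\<^sub>v y) $ i\<bar>)"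
      unfolding t vec_norm2_eq_L2_set dim_mult_mat_vec by (rule L2_set_le_sum_abs)
    also have "\<dots> \<le> (\<Sum>i\<in>{0..<dim_row M}. vec_norm2 (row M i))"
    proof (rule sum_mono)
      fix i assume i: "i \<in> {0..<dim_row M}"
      have "\<bar>row M i \<bullet> y\<bar> \<le> vec_norm2 (row M i) * vec_norm2 y"
        using y by (intro Cauchy_Schwarz_vec[of _ "dim_col M"]) auto
      also have "\<dots> \<le> vec_norm2 (row M i) * 1"
        using y by (intro mult_left_mono) (auto simp: vec_norm2_nonneg)
      finally show "\<bar>(M *\<^sub>v y) $ i\<bar> \<le> vec_norm2 (row M i)" using i by simp
    qed
    finally show "t \<le> (\<Sum>i\<in>{0..<dim_row M}. vec_norm2 (row M i))" .
  qed
  then show ?thesis unfolding mat_norm2_def using assms by (intro cSup_upper) auto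
qed

lemma mat_norm2_leI:
  assumes "\<And>x. x \<in> carrier_vec (dim_col M) \<Longrightarrow> vec_norm2 x \<le> 1 \<Longrightarrow> vec_norm2 (M *\<^sub>v x) \<le> c"
  shows "mat_norm2 M \<le> c"
  unfolding mat_norm2_def
proof (rule cSup_least)
  have "vec_norm2 (0\<^sub>v (dim_col M)) \<le> 1" by (simp add: vec_norm2_def)
  then show "{vec_norm2 (M *\<^sub>v x) | x. x \<in> carrier_vec (dim_col M) \<and> vec_norm2 x \<le> 1} \<noteq> {}"
    using zero_carrier_vec[of "dim_col M"] by blast
qed (use assms in auto)

lemma mat_norm2_triangle:
  assumes "M \<in> carrier_mat r c" "N \<in> carrier_mat r c"
  shows "mat_norm2 (M + N) \<le> mat_norm2 M + mat_norm2 N"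
proof (rule mat_norm2_leI)
  fix x assume x: "x \<in> carrier_vec (dim_col (M + N))" "vec_norm2 x \<le> 1"
  then have x': "x \<in> carrier_vec c" using assms by simp
  have "vec_norm2 ((M + N) *\<^sub>v x) = vec_norm2 (M *\<^sub>v x + N *\<^sub>v x)"
    using add_mult_distrib_mat_vec[OF assms x'] by simp
  also have "\<dots> \<le> vec_norm2 (M *\<^sub>v x) + vec_norm2 (N *\<^sub>v x)"
    using assms x' by (intro vec_norm2_triangle[of _ r]) auto
  also have "\<dots> \<le> mat_norm2 M + mat_norm2 N"
    using x x' assms by (intro add_mono vec_norm2_mult_mat_vec_le) auto
  finally show "vec_norm2 ((M + N) *\<^sub>v x) \<le> mat_norm2 M + mat_norm2 N" .
qed

section \<open>Matrices with orthonormal columns\<close>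

lemma vec_norm2_orthonormal_cols:
  assumes W: "W \<in> carrier_mat r c" "transpose_mat W * W = 1\<^sub>m c" and x: "x \<in> carrier_vec c"
  shows "vec_norm2 (W *\<^sub>v x) = vec_norm2 x"
proof -
  have "(W *\<^sub>v x) \<bullet> (W *\<^sub>v x) = (transpose_mat W *\<^sub>v (W *\<^sub>v x)) \<bullet> x"
    using transpose_vec_mult_scalar[OF W(1) x] W x by simp
  also have "transpose_mat W *\<^sub>v (W *\<^sub>v x) = (transpose_mat W * W) *\<^sub>v x"
    using W x by (intro assoc_mult_mat_vec[symmetric]) auto
  also have "\<dots> = x" using W x by simp
  finally show ?thesis by (simp add: vec_norm2_def)
qed

lemma vec_norm2_transpose_orthonormal_cols:
  assumes W: "W \<in> carrier_mat r c" "transpose_mat W * W = 1\<^sub>m c" and x: "x \<in> carrier_vec r"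
  shows "vec_norm2 (transpose_mat W *\<^sub>v x) \<le> vec_norm2 x"
proof (rule ccontr)
  let ?y = "transpose_mat W *\<^sub>v x"
  assume "\<not> vec_norm2 ?y \<le> vec_norm2 x"
  then have less: "vec_norm2 x < vec_norm2 ?y" by simp
  have y: "?y \<in> carrier_vec c" using W x by auto
  have "(vec_norm2 ?y)\<^sup>2 = x \<bullet> (W *\<^sub>v ?y)"
    unfolding vec_norm2_square by (rule transpose_vec_mult_scalar[OF W(1) y x])
  also have "\<dots> \<le> vec_norm2 x * vec_norm2 (W *\<^sub>v ?y)"
    using Cauchy_Schwarz_vec[of x r "W *\<^sub>v ?y"] W x y by (simp add: abs_le_iff)
  also have "\<dots> = vec_norm2 x * vec_norm2 ?y"
    using vec_norm2_orthonormal_cols[OF W y] by simp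
  also have "\<dots> < vec_norm2 ?y * vec_norm2 ?y"
    using less vec_norm2_nonneg[of x] by (intro mult_strict_right_mono) auto
  finally show False by (simp add: power2_eq_square)
qed

text \<open>A square matrix with orthonormal columns also has orthonormal rows.\<close>

lemma vec_norm2_transpose_orthogonal:
  assumes W: "W \<in> carrier_mat r r" "transpose_mat W * W = 1\<^sub>m r" and x: "x \<in> carrier_vec r"
  shows "vec_norm2 (transpose_mat W *\<^sub>v x) = vec_norm2 x"
proof -
  have "W * transpose_mat W = 1\<^sub>m r"
    using mat_mult_left_right_inverse[of "transpose_mat W" r W] W by auto
  then show ?thesis
    using W x by (intro vec_norm2_orthonormal_cols[of _ r r]) auto
qed

lemma orthonormal_cols_mat_of_cols:
  assumes "\<And>i. i \<in> {1..N} \<Longrightarrow> w i \<in> carrier_vec r"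
    and "\<And>i j. i \<in> {1..N} \<Longrightarrow> j \<in> {1..N} \<Longrightarrow> w i \<bullet> w j = (if i = j then 1 else 0 :: real)"
    and W: "W = mat_of_cols r (map w [1..<N + 1])"
  shows "transpose_mat W * W = 1\<^sub>m N"
proof (rule eq_matI)
  have dim: "dim_row W = r" "dim_col W = N" unfolding W by auto
  fix i j assume ij: "i < dim_row (1\<^sub>m N :: real mat)" "j < dim_col (1\<^sub>m N :: real mat)"
  have col: "col W l = w (Suc l)" if "l < N" for l
    unfolding W using that assms(1)[of "Suc l"] by (subst col_mat_of_cols) (auto simp del: upt_Suc)
  show "(transpose_mat W * W) $$ (i, j) = 1\<^sub>m N $$ (i, j)"
    using ij assms(2)[of "Suc i" "Suc j"] by (simp add: col dim)
qed (auto simp: W)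

section \<open>Singular values and norm bounds\<close>

lemma diag_rect_carrier [simp, intro!]: "diag_rect r c s \<in> carrier_mat r c"
  unfolding diag_rect_def by simp

lemma diag_rect_mult_vec_carrier [simp]: "diag_rect r c s *\<^sub>v y \<in> carrier_vec r"
  by (intro carrier_vecI) (simp add: diag_rect_def)

lemma diag_rect_transpose: "transpose_mat (diag_rect r c s) = diag_rect c r s"
  unfolding diag_rect_def by (intro eq_matI) auto

lemma diag_rect_mult_vec:
  assumes "y \<in> carrier_vec c" "i < r"
  shows "(diag_rect r c s *\<^sub>v y) $ i = (if i < c then s (Suc i) * y $ i else 0)"
proof -
  have "(diag_rect r c s *\<^sub>v y) $ i = (\<Sum>j\<in>{0..<c}. (if i = j then s (Suc i) else 0) * y $ j)"
    using assms by (simp add: diag_rect_def scalar_prod_def)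
  also have "\<dots> = (\<Sum>j\<in>{0..<c}. if i = j then s (Suc i) * y $ i else 0)"
    by (intro sum.cong) auto
  also have "\<dots> = (if i < c then s (Suc i) * y $ i else 0)" by simp
  finally show ?thesis .
qed

lemma is_svdD:
  assumes "is_svd M U s V" "M \<in> carrier_mat r c"
  shows "U \<in> carrier_mat r r" "transpose_mat U * U = 1\<^sub>m r"
    and "V \<in> carrier_mat c c" "transpose_mat V * V = 1\<^sub>m c"
    and "\<And>i. 1 \<le> i \<Longrightarrow> i \<le> min r c \<Longrightarrow> 0 \<le> s i"
    and "\<And>i j. 1 \<le> i \<Longrightarrow> i \<le> j \<Longrightarrow> j \<le> min r c \<Longrightarrow> s j \<le> s i"
    and "M = U * diag_rect r c s * transpose_mat V"
  using assms unfolding is_svd_def Let_def by auto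

lemma is_svd_transpose:
  assumes "is_svd M U s V"
  shows "is_svd (transpose_mat M) V s U"
proof -
  obtain r c where M: "M \<in> carrier_mat r c" by blast
  note svd = is_svdD[OF assms M]
  have "transpose_mat M = V * (transpose_mat (U * diag_rect r c s))"
    using svd by (subst svd(7), subst transpose_mult[of _ r c]) auto
  also have "transpose_mat (U * diag_rect r c s) = diag_rect c r s * transpose_mat U"
    using svd by (subst transpose_mult[of _ r r]) (auto simp: diag_rect_transpose)
  also have "V * (diag_rect c r s * transpose_mat U) = V * diag_rect c r s * transpose_mat U"
    using svd by (intro assoc_mult_mat[symmetric]) auto
  finally have "transpose_mat M = V * diag_rect c r s * transpose_mat U" .
  then show ?thesis
    unfolding is_svd_def Let_def using svd M by (simp add: min.commute)
qed

lemma svd_mult_vec: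
  assumes "U \<in> carrier_mat r r" "V \<in> carrier_mat c c" "x \<in> carrier_vec c"
  shows "(U * diag_rect r c s * transpose_mat V) *\<^sub>v x
    = U *\<^sub>v (diag_rect r c s *\<^sub>v (transpose_mat V *\<^sub>v x))"
proof -
  have "(U * diag_rect r c s * transpose_mat V) *\<^sub>v x
    = (U * diag_rect r c s) *\<^sub>v (transpose_mat V *\<^sub>v x)"
    using assms by (intro assoc_mult_mat_vec[of _ r c _ c] mult_carrier_mat[of _ r r]) auto
  also have "\<dots> = U *\<^sub>v (diag_rect r c s *\<^sub>v (transpose_mat V *\<^sub>v x))"
    using assms by (intro assoc_mult_mat_vec[of _ r r _ c]) auto
  finally show ?thesis .
qed

lemma smallest_singular_value_le:
  assumes svd: "is_svd M U s V" and M: "M \<in> carrier_mat N N" and "1 \<le> N"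
    and x: "x \<in> carrier_vec N"
  shows "s N * vec_norm2 x \<le> vec_norm2 (M *\<^sub>v x)"
proof -
  note D = is_svdD[OF svd M]
  define y where "y = transpose_mat V *\<^sub>v x"
  define z where "z = diag_rect N N s *\<^sub>v y"
  have y: "y \<in> carrier_vec N" and z: "z \<in> carrier_vec N" unfolding y_def z_def using D x by auto
  have "s N * \<bar>y $ i\<bar> \<le> 1 * \<bar>z $ i\<bar>" if "i < N" for i
  proof -
    have "0 \<le> s (Suc i)" "s N \<le> s (Suc i)" using D(5)[of "Suc i"] D(6)[of "Suc i" N] that by auto
    moreover have "z $ i = s (Suc i) * y $ i" unfolding z_def using diag_rect_mult_vec[OF y] that by simp
    ultimately show ?thesis by (simp add: abs_mult mult_right_mono)
  qed
  moreover have "0 \<le> s N" using D(5)[of N] \<open>1 \<le> N\<close> by simp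
  ultimately have "vec_norm2 (s N \<cdot>\<^sub>v y) \<le> 1 * vec_norm2 z"
    using y z by (intro vec_norm2_le_scaled[of _ N]) (auto simp: abs_mult)
  moreover have "M *\<^sub>v x = U *\<^sub>v z"
    unfolding z_def y_def by (subst D(7)) (use D x in \<open>simp only: svd_mult_vec\<close>)
  moreover have "vec_norm2 (U *\<^sub>v z) = vec_norm2 z" by (rule vec_norm2_orthonormal_cols[OF D(1,2) z])
  moreover have "vec_norm2 y = vec_norm2 x"
    unfolding y_def by (rule vec_norm2_transpose_orthogonal[OF D(3,4) x])
  ultimately show ?thesis using \<open>0 \<le> s N\<close> by (simp add: vec_norm2_smult)
qed

lemma smallest_singular_value_attained:
  assumes svd: "is_svd M U s V" and M: "M \<in> carrier_mat N N" and "1 \<le> N"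
  obtains x where "x \<in> carrier_vec N" "vec_norm2 x = 1" "vec_norm2 (M *\<^sub>v x) = s N"
proof
  note D = is_svdD[OF svd M]
  define e :: "real vec" where "e = unit_vec N (N - 1)"
  define x where "x = V *\<^sub>v e"
  have e: "e \<in> carrier_vec N" unfolding e_def by simp
  have norm_e: "vec_norm2 e = 1" unfolding vec_norm2_def e_def using \<open>1 \<le> N\<close> by simp
  show x: "x \<in> carrier_vec N" unfolding x_def using D e by auto
  show "vec_norm2 x = 1"
    unfolding x_def norm_e[symmetric] by (rule vec_norm2_orthonormal_cols[OF D(3,4) e])
  have "transpose_mat V *\<^sub>v x = (transpose_mat V * V) *\<^sub>v e"
    unfolding x_def using D(3) e by (intro assoc_mult_mat_vec[symmetric]) auto
  then have "transpose_mat V *\<^sub>v x = e" using D(4) e by simp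
  then have "M *\<^sub>v x = U *\<^sub>v (diag_rect N N s *\<^sub>v e)"
    by (subst D(7)) (use D x in \<open>simp only: svd_mult_vec\<close>)
  also have "diag_rect N N s *\<^sub>v e = s N \<cdot>\<^sub>v e"
  proof (rule eq_vecI)
    fix i assume "i < dim_vec (s N \<cdot>\<^sub>v e)"
    then have "i < N" using e by simp
    then show "(diag_rect N N s *\<^sub>v e) $ i = (s N \<cdot>\<^sub>v e) $ i"
      using diag_rect_mult_vec[OF e, of i N s] by (auto simp: e_def)
  qed (use e in \<open>auto simp: diag_rect_def\<close>)
  finally have "vec_norm2 (M *\<^sub>v x) = vec_norm2 (s N \<cdot>\<^sub>v e)"
    using vec_norm2_orthonormal_cols[OF D(1,2)] e by simp
  then show "vec_norm2 (M *\<^sub>v x) = s N"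
    using D(5)[of N] \<open>1 \<le> N\<close> norm_e by (simp add: vec_norm2_smult)
qed

text \<open>
  By the two preceding lemmas the last singular value of a square matrix is the minimum of
  \<open>\<parallel>M x\<parallel>\<close> over unit vectors \<open>x\<close>. It is therefore the same for every singular value decomposition.
\<close>

lemma smallest_singular_value_unique:
  assumes "is_svd M U s V" "is_singular_values M t" "M \<in> carrier_mat N N" "1 \<le> N"
  shows "t N = s N"
proof -
  obtain U' V' where t: "is_svd M U' t V'" using assms(2) unfolding is_singular_values_def by blast
  obtain x where x: "x \<in> carrier_vec N" "vec_norm2 x = 1" "vec_norm2 (M *\<^sub>v x) = s N"
    using smallest_singular_value_attained[OF assms(1,3,4)] .
  obtain y where y: "y \<in> carrier_vec N" "vec_norm2 y = 1" "vec_norm2 (M *\<^sub>v y) = t N"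
    using smallest_singular_value_attained[OF t assms(3,4)] .
  show ?thesis
    using smallest_singular_value_le[OF assms(1,3,4) y(1)]
      smallest_singular_value_le[OF t assms(3,4) x(1)] x y by simp
qed

text \<open>
  The decomposition that is truncated to obtain \<open>C\<close> need not be the one that exhibits \<open>t\<close>; only
  the uniqueness of the last singular value links them.
\<close>

lemma best_rank_approx_error:
  assumes approx: "is_best_rank_approx k M C" and sv: "is_singular_values M t"
    and M: "M \<in> carrier_mat (k + 1) (k + 1)" and x: "x \<in> carrier_vec (k + 1)"
  shows "C \<in> carrier_mat (k + 1) (k + 1)"
    and "vec_norm2 ((M - C) *\<^sub>v x) \<le> t (k + 1) * vec_norm2 x"
proof -
  let ?N = "k + 1"
  obtain U s V where svd: "is_svd M U s V"
    and C: "C = U * diag_rect ?N ?N (\<lambda>i. if i \<le> k then s i else 0) * transpose_mat V"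
    using approx M unfolding is_best_rank_approx_def by auto
  note D = is_svdD[OF svd M]
  let ?s = "\<lambda>i. if i \<le> k then s i else 0"
  show Cc: "C \<in> carrier_mat ?N ?N" unfolding C using D by auto
  define y where "y = transpose_mat V *\<^sub>v x"
  have y: "y \<in> carrier_vec ?N" unfolding y_def using D x by auto
  define z where "z = diag_rect ?N ?N s *\<^sub>v y - diag_rect ?N ?N ?s *\<^sub>v y"
  have z: "z \<in> carrier_vec ?N" unfolding z_def
    by (intro minus_carrier_vec diag_rect_mult_vec_carrier)
  have "(M - C) *\<^sub>v x = M *\<^sub>v x - C *\<^sub>v x"
    by (rule minus_mult_distrib_mat_vec[OF M Cc x])
  also have "M *\<^sub>v x = U *\<^sub>v (diag_rect ?N ?N s *\<^sub>v y)"
    unfolding y_def by (subst D(7)) (use D x in \<open>simp only: svd_mult_vec\<close>)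
  also have "C *\<^sub>v x = U *\<^sub>v (diag_rect ?N ?N ?s *\<^sub>v y)"
    unfolding y_def C using D x by (simp only: svd_mult_vec)
  also have "U *\<^sub>v (diag_rect ?N ?N s *\<^sub>v y) - U *\<^sub>v (diag_rect ?N ?N ?s *\<^sub>v y) = U *\<^sub>v z"
    unfolding z_def
    by (intro mult_minus_distrib_mat_vec[OF D(1), symmetric] diag_rect_mult_vec_carrier)
  finally have "vec_norm2 ((M - C) *\<^sub>v x) = vec_norm2 z"
    using vec_norm2_orthonormal_cols[OF D(1,2) z] by simp
  also have "\<dots> \<le> s ?N * vec_norm2 y"
  proof (rule vec_norm2_le_scaled[OF z y])
    show "0 \<le> s ?N" using D(5)[of ?N] by simp
    fix i assume i: "i < ?N"
    have "z $ i = (diag_rect ?N ?N s *\<^sub>v y) $ i - (diag_rect ?N ?N ?s *\<^sub>v y) $ i"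
      unfolding z_def using i by (intro index_minus_vec) (simp add: diag_rect_def)
    also have "\<dots> = (if i = k then s ?N * y $ i else 0)"
      using i diag_rect_mult_vec[OF y i] by auto
    finally show "\<bar>z $ i\<bar> \<le> s ?N * \<bar>y $ i\<bar>"
      using \<open>0 \<le> s ?N\<close> by (auto simp: abs_mult)
  qed
  also have "vec_norm2 y = vec_norm2 x"
    unfolding y_def by (rule vec_norm2_transpose_orthogonal[OF D(3,4) x])
  also have "s ?N = t ?N" using smallest_singular_value_unique[OF svd sv M] by simp
  finally show "vec_norm2 ((M - C) *\<^sub>v x) \<le> t ?N * vec_norm2 x" .
qed

text \<open>
  On the orthogonal complement of the first \<open>k\<close> left singular vectors, \<open>A\<^sup>T\<close> stretches by at most
  the next singular value.
\<close>

lemma svd_transpose_mult_vec_le: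
  assumes svd: "is_svd A U \<sigma> V" and A: "A \<in> carrier_mat m n" and "k < n" "n \<le> m"
    and z: "z \<in> carrier_vec m" and ortho: "\<And>i. i < k \<Longrightarrow> col U i \<bullet> z = 0"
  shows "vec_norm2 (transpose_mat A *\<^sub>v z) \<le> \<sigma> (k + 1) * vec_norm2 z"
proof -
  note D = is_svdD[OF svd A]
  note D' = is_svdD[OF is_svd_transpose[OF svd], of n m]
  define w where "w = transpose_mat U *\<^sub>v z"
  define y where "y = diag_rect n m \<sigma> *\<^sub>v w"
  have w: "w \<in> carrier_vec m" and y: "y \<in> carrier_vec n" unfolding w_def y_def using D z by auto
  \<comment> \<open>\<open>A\<^sup>T\<close> annihilates the left singular vectors beyond the \<open>n\<close>-th, so only \<open>n\<close> coordinates count.\<close>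
  define w' where "w' = vec n (\<lambda>i. w $ i)"
  have w': "w' \<in> carrier_vec n" unfolding w'_def by simp
  have "transpose_mat A = V * diag_rect n m \<sigma> * transpose_mat U" using D' A by simp
  then have "transpose_mat A *\<^sub>v z = V *\<^sub>v y"
    unfolding y_def w_def using D z by (simp only: svd_mult_vec)
  then have "vec_norm2 (transpose_mat A *\<^sub>v z) = vec_norm2 y"
    using vec_norm2_orthonormal_cols[OF D(3,4) y] by simp
  also have "\<dots> \<le> \<sigma> (k + 1) * vec_norm2 w'"
  proof (rule vec_norm2_le_scaled[OF y w'])
    show nonneg: "0 \<le> \<sigma> (k + 1)" using D(5)[of "k + 1"] assms by simp
    fix i assume i: "i < n"
    have yi: "y $ i = \<sigma> (Suc i) * w $ i"
      unfolding y_def using diag_rect_mult_vec[OF w i] i \<open>n \<le> m\<close> by simp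
    show "\<bar>y $ i\<bar> \<le> \<sigma> (k + 1) * \<bar>w' $ i\<bar>"
    proof (cases "i < k")
      case True
      then have "w $ i = 0" unfolding w_def using ortho D(1) i \<open>n \<le> m\<close> by simp
      then show ?thesis using yi i by (simp add: w'_def)
    next
      case False
      then have "0 \<le> \<sigma> (Suc i)" "\<sigma> (Suc i) \<le> \<sigma> (k + 1)"
        using D(5)[of "Suc i"] D(6)[of "k + 1" "Suc i"] i \<open>n \<le> m\<close> by auto
      then show ?thesis using yi i by (simp add: w'_def abs_mult mult_right_mono)
    qed
  qed
  also have "\<sigma> (k + 1) * vec_norm2 w' \<le> \<sigma> (k + 1) * vec_norm2 w"
  proof (rule mult_left_mono)
    have "w' \<bullet> w' \<le> w \<bullet> w"
      unfolding scalar_prod_def w'_def using w \<open>n \<le> m\<close> by (auto intro!: sum_mono2)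
    then show "vec_norm2 w' \<le> vec_norm2 w" unfolding vec_norm2_def by simp
    show "0 \<le> \<sigma> (k + 1)" using D(5)[of "k + 1"] assms by simp
  qed
  also have "vec_norm2 w = vec_norm2 z"
    unfolding w_def by (rule vec_norm2_transpose_orthogonal[OF D(1,2) z])
  finally show ?thesis .
qed

lemma nontrivial_solution_underdetermined:
  assumes "\<And>i. i < k \<Longrightarrow> c i \<in> carrier_vec (k + 1)"
  obtains y :: "real vec" where "y \<in> carrier_vec (k + 1)" "y \<noteq> 0\<^sub>v (k + 1)" "\<And>i. i < k \<Longrightarrow> c i \<bullet> y = 0"
proof -
  let ?c = "\<lambda>i. if i < k then c i else 0\<^sub>v (k + 1)"
  \<comment> \<open>A zero row turns the homogeneous system into a square one with zero determinant.\<close>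
  let ?M = "mat\<^sub>r (k + 1) (k + 1) (\<lambda>i. if i = k then 0\<^sub>v (k + 1) else ?c i)"
  have "det ?M = 0" using assms by (intro det_row_0) auto
  then obtain y where y: "y \<in> carrier_vec (k + 1)" "y \<noteq> 0\<^sub>v (k + 1)" and My: "?M *\<^sub>v y = 0\<^sub>v (k + 1)"
    using det_0_iff_vec_prod_zero_field[of ?M "k + 1"] by auto
  have "c i \<bullet> y = 0" if "i < k" for i
  proof -
    have "row ?M i = c i" using that assms by (subst row_mat_of_row_fun) auto
    then have "c i \<bullet> y = row ?M i \<bullet> y" by (simp only:)
    also have "\<dots> = (?M *\<^sub>v y) $ i" using that by (intro index_mult_mat_vec[symmetric]) simp
    also have "\<dots> = 0" unfolding My using that by simp
    finally show ?thesis .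
  qed
  with y that show ?thesis by blast
qed

section \<open>Lanczos bidiagonalization\<close>

text \<open>
  The two recurrences of the process, tested against an arbitrary vector. Orthogonality and the
  column space of \<open>A\<^sup>T P\<close> are read off from them.
\<close>

lemma lanczos_recurrences:
  assumes A: "A \<in> carrier_mat m n" and b: "b \<in> carrier_vec m" and "b \<noteq> 0\<^sub>v m"
    and lanczos: "lanczos_bidiag A b \<alpha> \<beta> p q"
    and \<alpha>: "\<forall>j\<in>{1..n}. 0 < \<alpha> j" and \<beta>: "\<forall>j\<in>{2..n}. 0 < \<beta> j"
  shows "\<And>j. j \<in> {1..n} \<Longrightarrow> p j \<in> carrier_vec m" and "\<And>j. j \<le> n \<Longrightarrow> q j \<in> carrier_vec n"
    and "\<And>j. j \<in> {1..n} \<Longrightarrow> p j \<bullet> p j = 1" and "\<And>j. j \<in> {1..n} \<Longrightarrow> q j \<bullet> q j = 1"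
    and "\<And>j x. j \<in> {1..n} \<Longrightarrow> x \<in> carrier_vec n \<Longrightarrow>
      p j \<bullet> (A *\<^sub>v x) = \<alpha> j * (q j \<bullet> x) + \<beta> j * (q (j - 1) \<bullet> x)"
    and "\<And>j y. j \<in> {1..<n} \<Longrightarrow> y \<in> carrier_vec m \<Longrightarrow>
      y \<bullet> (A *\<^sub>v q j) = \<beta> (j + 1) * (y \<bullet> p (j + 1)) + \<alpha> j * (y \<bullet> p j)"
proof -
  define r where "r j = transpose_mat A *\<^sub>v p j - \<beta> j \<cdot>\<^sub>v q (j - 1)" for j
  define z where "z j = A *\<^sub>v q j - \<alpha> j \<cdot>\<^sub>v p j" for j
  have p1: "p 1 = (1 / vec_norm2 b) \<cdot>\<^sub>v b" and q0: "q 0 = 0\<^sub>v n"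
    using lanczos A unfolding lanczos_bidiag_def by auto
  have step: "\<alpha> j = vec_norm2 (r j)" "q j = (1 / \<alpha> j) \<cdot>\<^sub>v r j"
      "\<beta> (j + 1) = vec_norm2 (z j)" "p (j + 1) = (1 / \<beta> (j + 1)) \<cdot>\<^sub>v z j"
    if "j \<in> {1..n}" for j
    using lanczos A that unfolding lanczos_bidiag_def r_def z_def Let_def by auto
  have unit: "((1 / vec_norm2 v) \<cdot>\<^sub>v v) \<bullet> ((1 / vec_norm2 v) \<cdot>\<^sub>v v) = 1" if "0 < vec_norm2 v" for v
    using that vec_norm2_square[of v, symmetric] by (simp add: power2_eq_square)
  have carrier: "p (j + 1) \<in> carrier_vec m \<and> q j \<in> carrier_vec n" if "j \<le> n" for j
    using that
  proof (induction j)
    case 0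
    show ?case using b p1 q0 by simp
  next
    case (Suc j)
    then have IH: "p (j + 1) \<in> carrier_vec m" "q j \<in> carrier_vec n" and j: "Suc j \<in> {1..n}" by auto
    have "r (Suc j) \<in> carrier_vec n" unfolding r_def using A IH by auto
    then have qc: "q (Suc j) \<in> carrier_vec n" by (subst step(2)[OF j]) simp
    have "z (Suc j) \<in> carrier_vec m" unfolding z_def using A IH qc by auto
    then have "p (Suc j + 1) \<in> carrier_vec m" by (subst step(4)[OF j]) simp
    with qc show ?case by blast
  qed
  show pc: "p j \<in> carrier_vec m" if "j \<in> {1..n}" for j using carrier[of "j - 1"] that by auto
  show qc: "q j \<in> carrier_vec n" if "j \<le> n" for j using carrier[of j] that by auto
  show "p j \<bullet> p j = 1" if j: "j \<in> {1..n}" for j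
  proof (cases "j = 1")
    case True
    then show ?thesis by (simp only: p1 unit[OF vec_norm2_pos[OF b \<open>b \<noteq> 0\<^sub>v m\<close>]])
  next
    case False
    define i where "i = j - 1"
    have i: "i \<in> {1..n}" "j = i + 1" and "0 < \<beta> j" using False j \<beta> unfolding i_def by auto
    then have "0 < vec_norm2 (z i)" using step(3) by simp
    then show ?thesis unfolding i(2) step(4)[OF i(1)] step(3)[OF i(1)] by (rule unit)
  qed
  show "q j \<bullet> q j = 1" if j: "j \<in> {1..n}" for j
  proof -
    have "0 < vec_norm2 (r j)" using bspec[OF \<alpha> j] step(1)[OF j] by (simp only:)
    then show ?thesis unfolding step(2)[OF j] step(1)[OF j] by (rule unit)
  qed
  show "p j \<bullet> (A *\<^sub>v x) = \<alpha> j * (q j \<bullet> x) + \<beta> j * (q (j - 1) \<bullet> x)"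
    if j: "j \<in> {1..n}" and x: "x \<in> carrier_vec n" for j x
  proof -
    have q': "q (j - 1) \<in> carrier_vec n" using qc[of "j - 1"] j by auto
    have "0 < \<alpha> j" using \<alpha> j by blast
    have "q j \<bullet> x = (1 / \<alpha> j) * (r j \<bullet> x)"
      using A x q' by (subst step(2)[OF j], subst scalar_prod_smult_left) (auto simp: r_def)
    then have "\<alpha> j * (q j \<bullet> x) = r j \<bullet> x" using \<open>0 < \<alpha> j\<close> by simp
    also have "\<dots> = (transpose_mat A *\<^sub>v p j) \<bullet> x - (\<beta> j \<cdot>\<^sub>v q (j - 1)) \<bullet> x"
      unfolding r_def using A x q' pc[OF j]
      by (intro minus_scalar_prod_distrib[of _ n]) auto
    also have "\<dots> = p j \<bullet> (A *\<^sub>v x) - \<beta> j * (q (j - 1) \<bullet> x)"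
      using transpose_vec_mult_scalar[OF A x pc[OF j]] x q' by simp
    finally show ?thesis by simp
  qed
  show "y \<bullet> (A *\<^sub>v q j) = \<beta> (j + 1) * (y \<bullet> p (j + 1)) + \<alpha> j * (y \<bullet> p j)"
    if j: "j \<in> {1..<n}" and y: "y \<in> carrier_vec m" for j y
  proof -
    have j': "j \<in> {1..n}" and "0 < \<beta> (j + 1)" using \<beta> j by auto
    have "y \<bullet> p (j + 1) = (1 / \<beta> (j + 1)) * (y \<bullet> z j)"
      using y pc[OF j'] by (subst step(4)[OF j'], subst scalar_prod_smult_right) (auto simp: z_def)
    then have "\<beta> (j + 1) * (y \<bullet> p (j + 1)) = y \<bullet> z j" using \<open>0 < \<beta> (j + 1)\<close> by simp
    also have "\<dots> = y \<bullet> (A *\<^sub>v q j) - y \<bullet> (\<alpha> j \<cdot>\<^sub>v p j)"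
      unfolding z_def using A y pc[OF j'] qc[of j] j
      by (intro scalar_prod_minus_distrib[of _ m]) auto
    also have "\<dots> = y \<bullet> (A *\<^sub>v q j) - \<alpha> j * (y \<bullet> p j)"
      using y pc[OF j'] by simp
    finally show ?thesis by simp
  qed
qed

lemma lanczos_orthonormal:
  assumes pc: "\<And>j. j \<in> {1..n} \<Longrightarrow> p j \<in> carrier_vec m" and qc: "\<And>j. j \<le> n \<Longrightarrow> q j \<in> carrier_vec n"
    and q0: "q 0 = 0\<^sub>v n"
    and p_unit: "\<And>j. j \<in> {1..n} \<Longrightarrow> p j \<bullet> p j = 1" and q_unit: "\<And>j. j \<in> {1..n} \<Longrightarrow> q j \<bullet> q j = 1"
    and rec_q: "\<And>j x. j \<in> {1..n} \<Longrightarrow> x \<in> carrier_vec n \<Longrightarrow>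
      p j \<bullet> (A *\<^sub>v x) = \<alpha> j * (q j \<bullet> x) + \<beta> j * (q (j - 1) \<bullet> x)"
    and rec_p: "\<And>j y. j \<in> {1..<n} \<Longrightarrow> y \<in> carrier_vec m \<Longrightarrow>
      y \<bullet> (A *\<^sub>v q j) = \<beta> (j + 1) * (y \<bullet> p (j + 1)) + \<alpha> j * (y \<bullet> p j)"
    and \<alpha>: "\<forall>j\<in>{1..n}. 0 < \<alpha> j" and \<beta>: "\<forall>j\<in>{2..n}. 0 < \<beta> j"
    and ij: "i \<in> {1..n}" "j \<in> {1..n}"
  shows "p i \<bullet> p j = (if i = j then 1 else 0 :: real)" and "q i \<bullet> q j = (if i = j then 1 else 0 :: real)"
proof -
  \<comment> \<open>In the step, \<open>p\<^bsub>j + 1\<^esub>\<close> comes before \<open>q\<^bsub>j + 1\<^esub>\<close>: each scalar product \<open>p\<^sub>a \<bullet> A q\<^sub>b\<close> is expanded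
    by both recurrences, and the two results are compared.\<close>
  have "p i \<bullet> p j = 0 \<and> q i \<bullet> q j = 0" if "1 \<le> i" "i < j" "j \<le> n" for i j
    using that
  proof (induction j arbitrary: i)
    case 0
    then show ?case by simp
  next
    case (Suc j)
    have j: "j \<in> {1..n}" "j \<in> {1..<n}" "Suc j \<in> {1..n}" using Suc.prems by auto
    have pos: "0 < \<alpha> (Suc j)" "0 < \<beta> (Suc j)" using \<alpha> \<beta> j by auto
    have p_old: "p a \<bullet> p j = (if a = j then 1 else 0)" if "1 \<le> a" "a \<le> j" for a
      using Suc.IH[of a] p_unit[of j] that j by auto
    have q_old: "q a \<bullet> q j = (if a = j then 1 else 0)" if "a \<le> j" for a
      using Suc.IH[of a] q_unit[of j] q0 qc[of j] that j by (cases "a = 0") auto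
    have p_orth: "p a \<bullet> p (Suc j) = 0" if a: "1 \<le> a" "a \<le> j" for a
    proof -
      have "\<beta> (Suc j) * (p a \<bullet> p (Suc j)) + \<alpha> j * (p a \<bullet> p j) = p a \<bullet> (A *\<^sub>v q j)"
        using rec_p[OF j(2) pc[of a]] a j by simp
      also have "\<dots> = \<alpha> a * (q a \<bullet> q j) + \<beta> a * (q (a - 1) \<bullet> q j)"
        using rec_q[of a "q j"] qc[of j] a j by simp
      finally show ?thesis
        using p_old[of a] q_old[of a] q_old[of "a - 1"] a pos by (auto split: if_splits)
    qed
    have i: "1 \<le> i" "i \<le> j" "i \<in> {1..<n}" using Suc.prems by auto
    have pi: "p i \<in> carrier_vec m" "p (i + 1) \<in> carrier_vec m" "p (Suc j) \<in> carrier_vec m"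
      and qi: "q i \<in> carrier_vec n" "q j \<in> carrier_vec n" "q (Suc j) \<in> carrier_vec n"
      using pc qc i j by auto
    have "\<alpha> (Suc j) * (q (Suc j) \<bullet> q i) + \<beta> (Suc j) * (q j \<bullet> q i) = p (Suc j) \<bullet> (A *\<^sub>v q i)"
      using rec_q[OF j(3) qi(1)] by simp
    also have "\<dots> = \<beta> (i + 1) * (p (Suc j) \<bullet> p (i + 1)) + \<alpha> i * (p (Suc j) \<bullet> p i)"
      by (rule rec_p[OF i(3) pi(3)])
    also have "p (Suc j) \<bullet> p i = 0"
      using p_orth[of i] i comm_scalar_prod[OF pi(1,3)] by simp
    also have "p (Suc j) \<bullet> p (i + 1) = (if i = j then 1 else 0)"
      using p_orth[of "i + 1"] i p_unit[OF j(3)] comm_scalar_prod[OF pi(2,3)] by auto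
    also have "q j \<bullet> q i = (if i = j then 1 else 0)"
      using q_old[of i] i comm_scalar_prod[OF qi(1,2)] by simp
    finally have "q (Suc j) \<bullet> q i = 0" using pos by (auto split: if_splits)
    then show ?case using p_orth[of i] i comm_scalar_prod[OF qi(1,3)] by simp
  qed
  note orth = this
  show "p i \<bullet> p j = (if i = j then 1 else 0)"
    using orth[of i j] orth[of j i] p_unit[of i] ij comm_scalar_prod[OF pc[of i] pc[of j]]
    by (cases i j rule: linorder_cases) auto
  show "q i \<bullet> q j = (if i = j then 1 else 0)"
    using orth[of i j] orth[of j i] q_unit[of i] ij comm_scalar_prod[OF qc[of i] qc[of j]]
    by (cases i j rule: linorder_cases) auto
qed

lemma mat_eq_if_mult_vec_eq:
  assumes "M \<in> carrier_mat r c" "N \<in> carrier_mat r c"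
    and "\<And>x. x \<in> carrier_vec c \<Longrightarrow> M *\<^sub>v x = N *\<^sub>v (x :: real vec)"
  shows "M = N"
proof (rule eq_matI)
  fix i j assume ij: "i < dim_row N" "j < dim_col N"
  have entry: "(L *\<^sub>v unit_vec c j) $ i = L $$ (i, j)" if "L \<in> carrier_mat r c" for L :: "real mat"
    using that ij assms by simp
  show "M $$ (i, j) = N $$ (i, j)"
    using entry[OF assms(1)] entry[OF assms(2)] assms(3)[of "unit_vec c j"] by simp
qed (use assms in auto)

text \<open>
  The projection onto the span of the \<open>q\<^sub>j\<close> may be dropped from \<open>P\<^sup>T A Q Q\<^sup>T\<close>, since
  \<open>A\<^sup>T p\<^sub>j\<close> is a combination of \<open>q\<^sub>j\<close> and \<open>q\<^bsub>j - 1\<^esub>\<close>.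
\<close>

lemma lanczos_Bbar_mult_transpose_Q:
  assumes A: "A \<in> carrier_mat m n" and "N \<le> n"
    and pc: "\<And>j. j \<in> {1..n} \<Longrightarrow> p j \<in> carrier_vec m" and qc: "\<And>j. j \<le> n \<Longrightarrow> q j \<in> carrier_vec n"
    and q0: "q 0 = 0\<^sub>v n"
    and rec_q: "\<And>j x. j \<in> {1..n} \<Longrightarrow> x \<in> carrier_vec n \<Longrightarrow>
      p j \<bullet> (A *\<^sub>v x) = \<alpha> j * (q j \<bullet> x) + \<beta> j * (q (j - 1) \<bullet> x)"
    and QQ: "transpose_mat (lanczos_Q A q N) * lanczos_Q A q N = 1\<^sub>m N"
  shows "lanczos_Bbar A p q N * transpose_mat (lanczos_Q A q N) = transpose_mat (lanczos_P A p N) * A"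
proof -
  define P Q where "P = lanczos_P A p N" and "Q = lanczos_Q A q N"
  have P: "P \<in> carrier_mat m N" and Q: "Q \<in> carrier_mat n N"
    using A unfolding P_def Q_def lanczos_P_def lanczos_Q_def carrier_mat_def by auto
  have colP: "col P i = p (Suc i)" and colQ: "col Q i = q (Suc i)" if "i < N" for i
    unfolding P_def Q_def lanczos_P_def lanczos_Q_def
    using that A pc[of "Suc i"] qc[of "Suc i"] \<open>N \<le> n\<close>
    by (subst col_mat_of_cols; auto simp del: upt_Suc)+
  have "transpose_mat P * A * Q * transpose_mat Q = transpose_mat P * A"
  proof (rule mat_eq_if_mult_vec_eq)
    fix x :: "real vec" assume x: "x \<in> carrier_vec n"
    define y where "y = Q *\<^sub>v (transpose_mat Q *\<^sub>v x)"
    have y: "y \<in> carrier_vec n" and Qx: "transpose_mat Q *\<^sub>v x \<in> carrier_vec N"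
      unfolding y_def using Q x by auto
    have "transpose_mat Q *\<^sub>v y = (transpose_mat Q * Q) *\<^sub>v (transpose_mat Q *\<^sub>v x)"
      unfolding y_def using Q Qx by (intro assoc_mult_mat_vec[symmetric, of _ N n _ N]) auto
    then have "transpose_mat Q *\<^sub>v y = transpose_mat Q *\<^sub>v x"
      using QQ Qx unfolding Q_def by simp
    then have "(transpose_mat Q *\<^sub>v y) $ i = (transpose_mat Q *\<^sub>v x) $ i" for i by simp
    then have q_y: "q (Suc i) \<bullet> y = q (Suc i) \<bullet> x" if "i < N" for i
      using that Q colQ[OF that] by (metis carrier_matD(2) index_mult_mat_vec index_transpose_mat(2) row_transpose)
    then have q_y': "q i \<bullet> y = q i \<bullet> x" if "i \<le> N" for i
      using that q0 x y by (cases i) auto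
    have "transpose_mat P *\<^sub>v (A *\<^sub>v y) = transpose_mat P *\<^sub>v (A *\<^sub>v x)"
    proof (rule eq_vecI)
      fix i assume "i < dim_vec (transpose_mat P *\<^sub>v (A *\<^sub>v x))"
      then have i: "i < N" using P by simp
      then have i': "Suc i \<in> {1..n}" using \<open>N \<le> n\<close> by auto
      have "p (Suc i) \<bullet> (A *\<^sub>v y) = p (Suc i) \<bullet> (A *\<^sub>v x)"
        using rec_q[OF i' x] rec_q[OF i' y] q_y'[of "Suc i"] q_y'[of i] i by simp
      then show "(transpose_mat P *\<^sub>v (A *\<^sub>v y)) $ i = (transpose_mat P *\<^sub>v (A *\<^sub>v x)) $ i"
        using i P colP[OF i] by simp
    qed simp
    moreover have "(transpose_mat P * A) *\<^sub>v w = transpose_mat P *\<^sub>v (A *\<^sub>v w)"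
      if "w \<in> carrier_vec n" for w
      using P A that by (intro assoc_mult_mat_vec[of _ N m _ n]) auto
    moreover have "(transpose_mat P * A * Q * transpose_mat Q) *\<^sub>v x
      = (transpose_mat P * A * Q) *\<^sub>v (transpose_mat Q *\<^sub>v x)"
      using P A Q x by (intro assoc_mult_mat_vec[of _ N N _ n]) auto
    moreover have "\<dots> = (transpose_mat P * A) *\<^sub>v y"
      unfolding y_def using P A Q Qx by (intro assoc_mult_mat_vec[of _ N n _ N]) auto
    ultimately show "(transpose_mat P * A * Q * transpose_mat Q) *\<^sub>v x = (transpose_mat P * A) *\<^sub>v x"
      using x y by metis
  qed (use P A Q in auto)
  then show ?thesis unfolding lanczos_Bbar_def P_def Q_def .
qed

section \<open>The smallest singular value of the projected matrix\<close>

lemma singular_value_projected_le: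
  assumes svd: "is_svd A U \<sigma> V" and A: "A \<in> carrier_mat m n" and "k < n" "n \<le> m"
    and P: "P \<in> carrier_mat m (k + 1)" "transpose_mat P * P = 1\<^sub>m (k + 1)"
    and Q: "Q \<in> carrier_mat n (k + 1)" "transpose_mat Q * Q = 1\<^sub>m (k + 1)"
    and B: "B \<in> carrier_mat (k + 1) (k + 1)" "is_singular_values B \<theta>"
    and BQ: "B * transpose_mat Q = transpose_mat P * A"
  shows "\<theta> (k + 1) \<le> \<sigma> (k + 1)"
proof -
  obtain U' V' where svdB: "is_svd B U' \<theta> V'" using B(2) unfolding is_singular_values_def by blast
  note D = is_svdD[OF svd A]
  \<comment> \<open>The \<open>k\<close> equations \<open>u\<^sub>i\<^sup>T P y = 0\<close> in \<open>k + 1\<close> unknowns have a nonzero solution.\<close>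
  have "transpose_mat P *\<^sub>v col U i \<in> carrier_vec (k + 1)" if "i < k" for i
    using P D(1) that \<open>k < n\<close> \<open>n \<le> m\<close> by auto
  from nontrivial_solution_underdetermined[of k "\<lambda>i. transpose_mat P *\<^sub>v col U i", OF this]
  obtain y where y: "y \<in> carrier_vec (k + 1)" "y \<noteq> 0\<^sub>v (k + 1)"
    and ortho: "\<And>i. i < k \<Longrightarrow> (transpose_mat P *\<^sub>v col U i) \<bullet> y = 0" by metis
  have Py: "P *\<^sub>v y \<in> carrier_vec m" using P y by auto
  have "col U i \<bullet> (P *\<^sub>v y) = 0" if "i < k" for i
    using col_dim[of U i]  ortho[OF that] transpose_vec_mult_scalar[OF P(1) y(1), of "col U i"]
      D(1) that \<open>k < n\<close> \<open>n \<le> m\<close> by simp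
  then have upper: "vec_norm2 (transpose_mat A *\<^sub>v (P *\<^sub>v y)) \<le> \<sigma> (k + 1) * vec_norm2 y"
    using svd_transpose_mult_vec_le[OF svd A \<open>k < n\<close> \<open>n \<le> m\<close> Py]
      vec_norm2_orthonormal_cols[OF P y(1)] by simp
  have "transpose_mat A * P = transpose_mat (transpose_mat P * A)"
    using P A by (subst transpose_mult[of _ "k + 1" m]) auto
  also have "\<dots> = Q * transpose_mat B"
    unfolding BQ[symmetric] using B Q by (subst transpose_mult[of _ "k + 1" "k + 1"]) auto
  finally have AP: "transpose_mat A * P = Q * transpose_mat B" .
  have "transpose_mat A *\<^sub>v (P *\<^sub>v y) = (transpose_mat A * P) *\<^sub>v y"
    using P A y by (intro assoc_mult_mat_vec[symmetric]) auto
  also have "\<dots> = Q *\<^sub>v (transpose_mat B *\<^sub>v y)"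
    unfolding AP using B Q y by (intro assoc_mult_mat_vec) auto
  finally have "vec_norm2 (transpose_mat A *\<^sub>v (P *\<^sub>v y)) = vec_norm2 (transpose_mat B *\<^sub>v y)"
    using vec_norm2_orthonormal_cols[OF Q, of "transpose_mat B *\<^sub>v y"] B y by simp
  moreover have "\<theta> (k + 1) * vec_norm2 y \<le> vec_norm2 (transpose_mat B *\<^sub>v y)"
    using smallest_singular_value_le[OF is_svd_transpose[OF svdB]] B y by simp
  ultimately have "\<theta> (k + 1) * vec_norm2 y \<le> \<sigma> (k + 1) * vec_norm2 y"
    using upper by simp
  then show ?thesis using vec_norm2_pos[OF y] by simp
qed

section \<open>The error of the truncated approximation\<close>

theorem theorem4p5:
  fixes A U V C :: "real mat" and b :: "real vec"
    and \<sigma> \<alpha> \<beta> \<theta> :: "nat \<Rightarrow> real" and p q :: "nat \<Rightarrow> real vec" and m n k :: nat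
  assumes "n \<le> m" and "A \<in> carrier_mat m n" and "b \<in> carrier_vec m"
    and "is_svd A U \<sigma> V"
    and "\<forall>i j. 1 \<le> i \<longrightarrow> i < j \<longrightarrow> j \<le> n \<longrightarrow> \<sigma> j < \<sigma> i"
    and "\<forall>i\<in>{1..n}. 0 < \<sigma> i"
    and "\<forall>i\<in>{1..n}. scalar_prod (col U (i - 1)) b \<noteq> 0"
    and "lanczos_bidiag A b \<alpha> \<beta> p q"
    and "\<forall>j\<in>{1..n}. 0 < \<alpha> j"
    and "\<forall>j\<in>{2..n}. 0 < \<beta> j"
    and "n < m \<longrightarrow> 0 < \<beta> (n + 1)"
    and "1 \<le> k" and "k \<le> n - 1"
    and "is_best_rank_approx k (lanczos_Bbar A p q (k + 1)) C"
    and "is_singular_values (lanczos_Bbar A p q (k + 1)) \<theta>"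
  shows "mat_norm2 (A - lanczos_P A p (k + 1) * C * transpose_mat (lanczos_Q A q (k + 1)))
           \<le> \<sigma> (k + 1) + gamma_cgme A p q (k + 1)
       \<and> mat_norm2 (A - lanczos_P A p (k + 1) * C * transpose_mat (lanczos_Q A q (k + 1)))
           \<le> \<theta> (k + 1) + gamma_cgme A p q (k + 1)
       \<and> gamma_cgme A p q (k + 1)
           = mat_norm2 ((1\<^sub>m m - lanczos_P A p (k + 1) * transpose_mat (lanczos_P A p (k + 1))) * A)"
proof -
  let ?N = "k + 1"
  define P Q B where "P = lanczos_P A p ?N" and "Q = lanczos_Q A q ?N" and "B = lanczos_Bbar A p q ?N"
  have A: "A \<in> carrier_mat m n" and "n \<le> m" and "k < n" and "?N \<le> n" using assms(1,2,12,13) by auto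
  \<comment> \<open>Otherwise \<open>b\<close> would be orthogonal to \<open>u\<^sub>1\<close>.\<close>
  have "b \<noteq> 0\<^sub>v m"
  proof
    assume "b = 0\<^sub>v m"
    moreover have "col U 0 \<in> carrier_vec m"
      using is_svdD(1)[OF assms(4) A] \<open>n \<le> m\<close> \<open>k < n\<close> by auto
    ultimately have "col U (1 - 1) \<bullet> b = 0" by simp
    then show False using bspec[OF assms(7), of 1] \<open>k < n\<close> by simp
  qed
  note rec = lanczos_recurrences[OF A assms(3) \<open>b \<noteq> 0\<^sub>v m\<close> assms(8-10)]
  have q0: "q 0 = 0\<^sub>v n" using assms(8) A unfolding lanczos_bidiag_def by auto
  note orth = lanczos_orthonormal[OF rec(1,2) q0 rec(3-6) assms(9,10)]
  have P: "P \<in> carrier_mat m ?N" and Q: "Q \<in> carrier_mat n ?N"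
    using A unfolding P_def Q_def lanczos_P_def lanczos_Q_def carrier_mat_def by auto
  have PP: "transpose_mat P * P = 1\<^sub>m ?N"
  proof (rule orthonormal_cols_mat_of_cols)
    show "P = mat_of_cols m (map p [1..<?N + 1])" unfolding P_def lanczos_P_def using A by simp
    show "p i \<in> carrier_vec m" if "i \<in> {1..?N}" for i using rec(1)[of i] that \<open>?N \<le> n\<close> by simp
    show "p i \<bullet> p j = (if i = j then 1 else 0)" if "i \<in> {1..?N}" "j \<in> {1..?N}" for i j
      using orth(1)[of i j] that \<open>?N \<le> n\<close> by simp
  qed
  have QQ: "transpose_mat Q * Q = 1\<^sub>m ?N"
  proof (rule orthonormal_cols_mat_of_cols)
    show "Q = mat_of_cols n (map q [1..<?N + 1])" unfolding Q_def lanczos_Q_def using A by simp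
    show "q i \<in> carrier_vec n" if "i \<in> {1..?N}" for i using rec(2)[of i] that \<open>?N \<le> n\<close> by simp
    show "q i \<bullet> q j = (if i = j then 1 else 0)" if "i \<in> {1..?N}" "j \<in> {1..?N}" for i j
      using orth(2)[of i j] that \<open>?N \<le> n\<close> by simp
  qed
  have B: "B \<in> carrier_mat ?N ?N"
    unfolding B_def lanczos_Bbar_def using A P Q by (simp add: P_def Q_def)
  have BQ: "B * transpose_mat Q = transpose_mat P * A"
    unfolding B_def P_def Q_def
    using lanczos_Bbar_mult_transpose_Q[OF A \<open>?N \<le> n\<close> rec(1,2) q0 rec(5)] QQ by (simp add: Q_def)
  have approx: "is_best_rank_approx k B C" and sv: "is_singular_values B \<theta>"
    using assms(14,15) unfolding B_def by auto
  have C: "C \<in> carrier_mat ?N ?N"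
    by (rule best_rank_approx_error(1)[OF approx sv B zero_carrier_vec])
  define R where "R = A - P * B * transpose_mat Q"
  have R: "R \<in> carrier_mat m n" unfolding R_def using A P B Q by auto
  have gamma: "gamma_cgme A p q ?N = mat_norm2 R"
    unfolding gamma_cgme_def R_def P_def Q_def B_def ..
  have "P * B * transpose_mat Q = P * (transpose_mat P * A)"
    unfolding BQ[symmetric] using P B Q by (intro assoc_mult_mat) auto
  also have "\<dots> = P * transpose_mat P * A"
    using P A by (intro assoc_mult_mat[symmetric]) auto
  finally have "R = (1\<^sub>m m - P * transpose_mat P) * A"
    unfolding R_def using minus_mult_distrib_mat[of "1\<^sub>m m" m m "P * transpose_mat P" A n] P A by simp
  then have gamma_eq: "gamma_cgme A p q ?N = mat_norm2 ((1\<^sub>m m - P * transpose_mat P) * A)"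
    using gamma by simp
  define E where "E = P * (B - C) * transpose_mat Q"
  have E: "E \<in> carrier_mat m n" unfolding E_def using P B C Q by auto
  have "E = P * B * transpose_mat Q - P * C * transpose_mat Q"
    unfolding E_def using P B C Q
    by (subst mult_minus_distrib_mat[of _ m ?N _ ?N], (auto)[3],
        subst minus_mult_distrib_mat[of _ m ?N _ _ n]) auto
  then have split: "A - P * C * transpose_mat Q = R + E"
    unfolding R_def using A P B C Q by (intro eq_matI) auto
  have "mat_norm2 E \<le> \<theta> ?N"
  proof (rule mat_norm2_leI)
    fix x assume x: "x \<in> carrier_vec (dim_col E)" "vec_norm2 x \<le> 1"
    then have x': "x \<in> carrier_vec n" using E by auto
    let ?y = "transpose_mat Q *\<^sub>v x"
    have y: "?y \<in> carrier_vec ?N" using Q x' by auto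
    have BCy: "(B - C) *\<^sub>v ?y \<in> carrier_vec ?N" by (intro mult_mat_vec_carrier[OF minus_carrier_mat[OF C] y])
    obtain U' V' where svdB: "is_svd B U' \<theta> V'" using sv unfolding is_singular_values_def by blast
    have \<theta>: "0 \<le> \<theta> ?N" using is_svdD(5)[OF svdB B, of ?N] by simp
    have "E *\<^sub>v x = (P * (B - C)) *\<^sub>v ?y"
      unfolding E_def using P B C Q x' by (intro assoc_mult_mat_vec[of _ m ?N _ n]) auto
    also have "\<dots> = P *\<^sub>v ((B - C) *\<^sub>v ?y)"
      using P B C y by (intro assoc_mult_mat_vec[of _ m ?N _ ?N]) auto
    finally have "vec_norm2 (E *\<^sub>v x) = vec_norm2 ((B - C) *\<^sub>v ?y)"
      using vec_norm2_orthonormal_cols[OF P PP BCy] by simp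
    also have "\<dots> \<le> \<theta> ?N * vec_norm2 ?y" by (rule best_rank_approx_error(2)[OF approx sv B y])
    also have "\<dots> \<le> \<theta> ?N * 1"
      using vec_norm2_transpose_orthonormal_cols[OF Q QQ x'] x(2) \<theta> by (intro mult_left_mono) auto
    finally show "vec_norm2 (E *\<^sub>v x) \<le> \<theta> ?N" by simp
  qed
  then have "mat_norm2 (A - P * C * transpose_mat Q) \<le> \<theta> ?N + gamma_cgme A p q ?N"
    unfolding split gamma using mat_norm2_triangle[OF R E] by simp
  moreover have "\<theta> ?N \<le> \<sigma> ?N"
    by (rule singular_value_projected_le[OF assms(4) A \<open>k < n\<close> \<open>n \<le> m\<close> P PP Q QQ B sv BQ])
  ultimately show ?thesis using gamma_eq unfolding P_def Q_def by simp
qed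

end
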